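(* Let $(A,B)$ be a non-empty, closed, weakly compact, convex, sharp proximinal pair of subsets of a Banach space $X$, and let $T:A\cup B\to A\cup B$ be a pointwise cyclic contraction with respect to orbits. Then $T$ has a best proximity pair.
   Context: Let $X$ be a Banach space and $A,B\subseteq X$ non-empty. Notation: $d(A,B)=\inf\{\|x-y\|:x\in A,\ y\in B\}$; for a point $x$ and a non-empty set $S$, $\delta(x,S)=\sup\{\|x-y\|:y\in S\}$. A property such as closed, convex, weakly compact holds for a pair when it holds for both sets. The pair $(A,B)$ is proximinal if for every $x\in A$ there is $y\in B$ with $\|x-y\|=d(A,B)$, and for every $x\in B$ there is $y\in A$ with $\|x-y\|=d(A,B)$. It is sharp proximinal if in each case such a $y$ is moreover unique. A map $T:A\cup B\to A\cup B$ is cyclic if $T(A)\subseteq B$ and $T(B)\subseteq A$. For $x\in A\cup B$, $\mathcal{O}^2(x)=\{T^{2n}x:n\in\mathbb{N}\cup\{0\}\}$, and $r_x(\mathcal{O}^2(y))=\delta(x,\mathcal{O}^2(y))=\sup_{n\ge 0}\|x-T^{2n}y\|$. A cyclic map $T$ on $A\cup B$ is a pointwise cyclic contraction with respect to orbits if (i) $\|Tx-Ty\|=d(A,B)$ whenever $(x,y)\in A\times B$ and $\|x-y\|=d(A,B)$; and (ii) for each $(x,w)\in A\times B$ there exist $\alpha(x),\alpha(w)\in(0,1)$ such that $\|Tx-Ty\|\le\alpha(x)\,r_x(\mathcal{O}^2(y))+(1-\alpha(x))\,d(A,B)$ for all $y\in B$, and $\|Tw-Tu\|\le\alpha(w)\,r_w(\mathcal{O}^2(u))+(1-\alpha(w))\,d(A,B)$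 for all $u\in A$. (Here $\alpha(x)$ depends only on $x$ and $\alpha(w)$ only on $w$.) A best proximity pair for a cyclic map $T$ on $A\cup B$ is a pair $(x,y)\in A\times B$ with $\|x-Tx\|=\|y-Ty\|=d(A,B)$. *)

theory Defs
  imports "HOL-Analysis.Analysis"
begin

definition weak_topology :: "'a::real_normed_vector topology" where
  "weak_topology =
     topology_generated_by {f -` U | (f :: 'a \<Rightarrow> real) U. bounded_linear f \<and> open U}"

abbreviation weakly_compact :: "'a::real_normed_vector set \<Rightarrow> bool" where
  "weakly_compact S \<equiv> compactin weak_topology S"

text \<open>For non-empty sets, \<^const>\<open>setdist\<close> is the distance $d(A,B)$.\<close>

definition proximinal_pair :: "'a::real_normed_vector set \<Rightarrow> 'a set \<Rightarrow> bool" where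
  "proximinal_pair A B \<longleftrightarrow>
     (\<forall>x\<in>A. \<exists>y\<in>B. norm (x - y) = setdist A B) \<and>
     (\<forall>x\<in>B. \<exists>y\<in>A. norm (x - y) = setdist A B)"

definition sharp_proximinal_pair :: "'a::real_normed_vector set \<Rightarrow> 'a set \<Rightarrow> bool" where
  "sharp_proximinal_pair A B \<longleftrightarrow>
     (\<forall>x\<in>A. \<exists>!y. y \<in> B \<and> norm (x - y) = setdist A B) \<and>
     (\<forall>x\<in>B. \<exists>!y. y \<in> A \<and> norm (x - y) = setdist A B)"

lemma sharp_proximinal_pair_imp_proximinal_pair:
  "sharp_proximinal_pair A B \<Longrightarrow> proximinal_pair A B"
  unfolding sharp_proximinal_pair_def proximinal_pair_def by blast

definition cyclic_map :: "'a set \<Rightarrow> 'a set \<Rightarrow> ('a \<Rightarrow> 'a) \<Rightarrow> bool" where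
  "cyclic_map A B T \<longleftrightarrow> T ` A \<subseteq> B \<and> T ` B \<subseteq> A"

definition orbit2 :: "('a \<Rightarrow> 'a) \<Rightarrow> 'a \<Rightarrow> 'a set" where
  "orbit2 T x = {(T ^^ (2 * n)) x | n. True}"

text \<open>
  The supremum $\delta(x,S)$ is taken in the reals, so it has its usual meaning only for
  non-empty bounded \<open>S\<close>. Below, \<open>S\<close> is an orbit contained in one of the sets of the pair,
  and weakly compact sets are bounded.
\<close>

definition farthest_dist :: "'a::real_normed_vector \<Rightarrow> 'a set \<Rightarrow> real" where
  "farthest_dist x S = (SUP y\<in>S. norm (x - y))"

text \<open>
  \<open>T\<close> is a total function of which only the values on \<open>A \<union> B\<close> matter. The contraction
  constants are quantified so that the one for \<open>x \<in> A\<close> depends on \<open>x\<close> only, and likewise for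
  \<open>w \<in> B\<close>.
\<close>

definition pointwise_cyclic_contraction_orbits ::
    "'a::real_normed_vector set \<Rightarrow> 'a set \<Rightarrow> ('a \<Rightarrow> 'a) \<Rightarrow> bool" where
  "pointwise_cyclic_contraction_orbits A B T \<longleftrightarrow>
     cyclic_map A B T \<and>
     (\<forall>x\<in>A. \<forall>y\<in>B. norm (x - y) = setdist A B \<longrightarrow> norm (T x - T y) = setdist A B) \<and>
     (\<forall>x\<in>A. \<exists>\<alpha>. 0 < \<alpha> \<and> \<alpha> < 1 \<and>
        (\<forall>y\<in>B. norm (T x - T y)
                  \<le> \<alpha> * farthest_dist x (orbit2 T y) + (1 - \<alpha>) * setdist A B)) \<and>
     (\<forall>w\<in>B. \<exists>\<alpha>. 0 < \<alpha> \<and> \<alpha> < 1 \<and>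
        (\<forall>u\<in>A. norm (T w - T u)
                  \<le> \<alpha> * farthest_dist w (orbit2 T u) + (1 - \<alpha>) * setdist A B))"

definition best_proximity_pair ::
    "'a::real_normed_vector set \<Rightarrow> 'a set \<Rightarrow> ('a \<Rightarrow> 'a) \<Rightarrow> 'a \<times> 'a \<Rightarrow> bool" where
  "best_proximity_pair A B T = (\<lambda>(x, y).
     x \<in> A \<and> y \<in> B \<and> norm (x - T x) = setdist A B \<and> norm (y - T y) = setdist A B)"

end

theory Submission
  imports Defs
begin

text \<open>
  Write $d = d(A,B)$. Sharpness gives every $x \in A$ a unique partner $Jx \in B$ with
  $\|x - Jx\| = d$. As $T$ preserves distance $d$, the map $S = T \circ J$ sends $A$ into $A$ and
  satisfies $Tx = J(Sx)$. A fixed point $x$ of $S$ would give the best proximity pair $(x, Jx)$.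

  Among the non-empty convex subsets of $A$ that are weakly closed in $A$ and invariant under $S$
  there is a minimal one, $K$, by weak compactness and Zorn's lemma. Its partner set $J(K)$ plays
  the same role in $B$. Minimality says that any convex, weakly closed condition that holds on
  $S(K)$ holds on all of $K$. Now let $z \in K$ have distance at most $r$ to all of $J(K)$, and let
  $Jz$ have distance at most $r$ to all of $K$. Orbits under $T^2$ stay in $K$ or in $J(K)$, so the
  two contraction inequalities at $z$ and $Jz$ bound the distance from $Tz = J(Sz)$ to $S(K)$ and
  from $Sz = T(Jz)$ to $J(S(K))$ by some $s$ with $d \le s \le r$, and $s < r$ if $d < r$. By
  minimality $S(K)$ may be replaced by $K$ here, so $Sz$ has the property of $z$ with $s$ in place
  of $r$. The points having the property for a given $r \ge d$ therefore form an invariant convex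
  weakly closed set, so there are none or they exhaust $K$. If the largest distance $\rho$ between
  $K$ and $J(K)$ exceeded $d$, the step from $r = \rho$ to some $s < \rho$ would make all these
  distances at most $s$, which is absurd. Hence all distances between $K$ and $J(K)$ equal $d$, and
  every $z \in K$ gives the pair $(z, Jz)$.

  Three facts about the weak topology enter. Norm balls are weakly closed, by the
  Hahn-Banach theorem. Weakly compact sets are bounded, by Baire's theorem in the dual space; this
  makes $\rho$ finite. The condition $\|Jx - c\| \le r$ on $x \in A$ is weakly closed,
  because the graph of $J$ is weakly closed in $A \times B$ and $B$ is weakly compact; it is convex
  because $J$ is affine.
\<close>

section \<open>The Hahn-Banach theorem\<close>

definition sublinear :: "('a::real_vector \<Rightarrow> real) \<Rightarrow> bool" where
  "sublinear p \<longleftrightarrow> (\<forall>x y. p (x + y) \<le> p x + p y) \<and> (\<forall>c>0. \<forall>x. p (c *\<^sub>R x) \<le> c * p x)"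

lemma sublinear_add: "sublinear p \<Longrightarrow> p (x + y) \<le> p x + p y"
  by (simp add: sublinear_def)

lemma sublinear_scaleR:
  assumes "sublinear p" "c > 0"
  shows "p (c *\<^sub>R x) = c * p x"
proof (rule antisym)
  show "p (c *\<^sub>R x) \<le> c * p x"
    using assms by (simp add: sublinear_def)
  have "p ((1 / c) *\<^sub>R (c *\<^sub>R x)) \<le> (1 / c) * p (c *\<^sub>R x)"
    using assms unfolding sublinear_def by (meson zero_less_divide_1_iff)
  then show "c * p x \<le> p (c *\<^sub>R x)"
    using \<open>c > 0\<close> by (simp add: field_simps)
qed

lemma sublinear_zero: "sublinear p \<Longrightarrow> p 0 = 0"
  using sublinear_scaleR[of p 2 0] by simp

lemma sublinear_ge_minus: "sublinear p \<Longrightarrow> - p (- x) \<le> p x"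
  using sublinear_add[of p x "- x"] sublinear_zero[of p] by simp

text \<open>
  The largest sublinear functional below \<open>p\<close> that takes the value $-p(v)$ at $-v$, so that it
  is linear on the line through \<open>v\<close>.
\<close>

definition flatten_along :: "('a::real_vector \<Rightarrow> real) \<Rightarrow> 'a \<Rightarrow> 'a \<Rightarrow> real" where
  "flatten_along p v x = (INF t\<in>{0..}. p (x + t *\<^sub>R v) - t * p v)"

lemma flatten_along_le:
  assumes "sublinear p" "t \<ge> 0"
  shows "flatten_along p v x \<le> p (x + t *\<^sub>R v) - t * p v"
  unfolding flatten_along_def
proof (rule cINF_lower)
  have "- p (- x) \<le> p (x + t *\<^sub>R v) - t * p v" if "t \<ge> 0" for t
  proof (cases "t = 0")
    case True
    then show ?thesis using sublinear_ge_minus[OF assms(1)] by simp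
  next
    case False
    then have "t * p v = p (t *\<^sub>R v)"
      using that by (simp add: sublinear_scaleR[OF assms(1)])
    also have "\<dots> \<le> p (x + t *\<^sub>R v) + p (- x)"
      using sublinear_add[OF assms(1), of "x + t *\<^sub>R v" "- x"] by simp
    finally show ?thesis by simp
  qed
  then show "bdd_below ((\<lambda>t. p (x + t *\<^sub>R v) - t * p v) ` {0..})"
    by (auto intro!: bdd_belowI)
qed (use assms in auto)

lemma flatten_along_le_self: "sublinear p \<Longrightarrow> flatten_along p v x \<le> p x"
  using flatten_along_le[of p 0 v x] by simp

lemma flatten_along_minus: "sublinear p \<Longrightarrow> flatten_along p v (- v) \<le> - p v"
  using flatten_along_le[of p 1 v "- v"] by (simp add: sublinear_zero)

lemma flatten_along_greatest:
  "(\<And>t. t \<ge> 0 \<Longrightarrow> a \<le> p (x + t *\<^sub>R v) - t * p v) \<Longrightarrow> a \<le> flatten_along p v x"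
  unfolding flatten_along_def by (rule cINF_greatest) auto

lemma sublinear_flatten_along:
  assumes "sublinear p"
  shows "sublinear (flatten_along p v)"
  unfolding sublinear_def
proof (intro conjI allI impI)
  let ?q = "flatten_along p v"
  fix x y
  have "?q (x + y) - (p (x + s *\<^sub>R v) - s * p v) \<le> p (y + t *\<^sub>R v) - t * p v"
    if "s \<ge> 0" "t \<ge> 0" for s t
  proof -
    have "?q (x + y) \<le> p ((x + s *\<^sub>R v) + (y + t *\<^sub>R v)) - (s + t) * p v"
      using flatten_along_le[OF assms, of "s + t" v "x + y"] that
      by (simp add: algebra_simps)
    also have "\<dots> \<le> p (x + s *\<^sub>R v) + p (y + t *\<^sub>R v) - (s + t) * p v"
      using sublinear_add[OF assms] by (meson diff_right_mono)
    finally show ?thesis by (simp add: algebra_simps)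
  qed
  then have "?q (x + y) - (p (x + s *\<^sub>R v) - s * p v) \<le> ?q y" if "s \<ge> 0" for s
    using that by (blast intro: flatten_along_greatest)
  then have "?q (x + y) - ?q y \<le> p (x + s *\<^sub>R v) - s * p v" if "s \<ge> 0" for s
    using that by fastforce
  then have "?q (x + y) - ?q y \<le> ?q x"
    by (blast intro: flatten_along_greatest)
  then show "?q (x + y) \<le> ?q x + ?q y" by simp
next
  let ?q = "flatten_along p v"
  fix c :: real and x assume "c > 0"
  have "?q (c *\<^sub>R x) / c \<le> p (x + t *\<^sub>R v) - t * p v" if "t \<ge> 0" for t
  proof -
    have "?q (c *\<^sub>R x) \<le> p (c *\<^sub>R (x + t *\<^sub>R v)) - (c * t) * p v"
      using flatten_along_le[OF assms, of "c * t" v "c *\<^sub>R x"] that \<open>c > 0\<close>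
      by (simp add: algebra_simps)
    also have "\<dots> = c * (p (x + t *\<^sub>R v) - t * p v)"
      using sublinear_scaleR[OF assms \<open>c > 0\<close>] by (simp add: right_diff_distrib)
    finally show ?thesis using \<open>c > 0\<close> by (simp add: field_simps)
  qed
  then have "?q (c *\<^sub>R x) / c \<le> ?q x" by (rule flatten_along_greatest)
  then show "?q (c *\<^sub>R x) \<le> c * ?q x" using \<open>c > 0\<close> by (simp add: field_simps)
qed

text \<open>
  Flattening along \<open>v\<close> cannot decrease a minimal \<open>q\<close>, which forces $q(-v) = -q(v)$ for
  every \<open>v\<close>; an odd sublinear functional is linear.
\<close>

lemma minimal_sublinear_imp_linear:
  assumes "sublinear q"
    and minimal: "\<And>r. sublinear r \<Longrightarrow> r \<le> q \<Longrightarrow> r = q"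
  shows "linear q"
proof (rule linearI)
  have "flatten_along q v = q" for v
    by (intro minimal sublinear_flatten_along assms(1)) (simp add: le_fun_def flatten_along_le_self assms(1))
  then have neg: "q (- v) = - q v" for v
    using flatten_along_minus[OF assms(1), of v] sublinear_ge_minus[OF assms(1), of v] by simp
  show "q (x + y) = q x + q y" for x y
    using sublinear_add[OF assms(1), of x y] sublinear_add[OF assms(1), of "- x" "- y"]
      neg[of x] neg[of y] neg[of "x + y"] by simp
  show "q (c *\<^sub>R x) = c *\<^sub>R q x" for c x
  proof (cases c "0 :: real" rule: linorder_cases)
    case less
    then show ?thesis
      using sublinear_scaleR[OF assms(1), of "- c" x] neg[of "c *\<^sub>R x"] by simp
  qed (use sublinear_scaleR[OF assms(1)] sublinear_zero[OF assms(1)] in auto)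
qed

text \<open>
  A pointwise infimum of sublinear functionals need not be subadditive. In a chain it is: functionals
  that nearly attain the infimum at \<open>x\<close> and at \<open>y\<close> can be replaced by the smaller of the two.
\<close>

lemma sublinear_INF_chain:
  assumes "C \<noteq> {}"
    and sub: "\<And>q. q \<in> C \<Longrightarrow> sublinear q"
    and lin: "\<And>q r. q \<in> C \<Longrightarrow> r \<in> C \<Longrightarrow> q \<le> r \<or> r \<le> q"
    and bdd: "\<And>x. bdd_below ((\<lambda>q. q x) ` C)"
  shows "sublinear (\<lambda>x. INF q\<in>C. q x)"
  unfolding sublinear_def
proof (intro conjI allI impI)
  let ?m = "\<lambda>x. INF q\<in>C. q x"
  have lower: "?m x \<le> q x" if "q \<in> C" for q x
    using bdd that by (rule cINF_lower)
  have greatest: "a \<le> ?m x" if "\<And>q. q \<in> C \<Longrightarrow> a \<le> q x" for a x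
    using assms(1) that by (rule cINF_greatest)
  fix x y
  have "?m (x + y) - q x \<le> r y" if q: "q \<in> C" and r: "r \<in> C" for q r
  proof -
    obtain s where "s \<in> C" "s \<le> q" "s \<le> r"
      using lin[OF q r] q r by blast
    have "?m (x + y) \<le> s x + s y"
      using lower[OF \<open>s \<in> C\<close>] sublinear_add[OF sub[OF \<open>s \<in> C\<close>]] by (meson order_trans)
    also have "\<dots> \<le> q x + r y"
      using \<open>s \<le> q\<close> \<open>s \<le> r\<close> by (intro add_mono) (auto simp: le_fun_def)
    finally show ?thesis by simp
  qed
  then have "?m (x + y) - q x \<le> ?m y" if "q \<in> C" for q
    using that by (blast intro: greatest)
  then have "?m (x + y) - ?m y \<le> q x" if "q \<in> C" for q
    using that by fastforce
  then have "?m (x + y) - ?m y \<le> ?m x" by (rule greatest)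
  then show "?m (x + y) \<le> ?m x + ?m y" by simp
next
  let ?m = "\<lambda>x. INF q\<in>C. q x"
  fix c :: real and x :: 'a assume "c > 0"
  have "?m (c *\<^sub>R x) / c \<le> q x" if "q \<in> C" for q
  proof -
    have "?m (c *\<^sub>R x) \<le> q (c *\<^sub>R x)"
      using bdd that by (rule cINF_lower)
    then show ?thesis
      using sublinear_scaleR[OF sub[OF that] \<open>c > 0\<close>] \<open>c > 0\<close> by (simp add: field_simps)
  qed
  then have "?m (c *\<^sub>R x) / c \<le> ?m x"
    by (intro cINF_greatest assms(1))
  then show "?m (c *\<^sub>R x) \<le> c * ?m x" using \<open>c > 0\<close> by (simp add: field_simps)
qed

text \<open>
  Zorn's lemma supplies a minimal sublinear functional below \<open>p\<close>, and minimal ones are linear.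
\<close>

theorem linear_functional_below_sublinear:
  fixes p :: "'a::real_vector \<Rightarrow> real"
  assumes "sublinear p"
  obtains f where "linear f" "f \<le> p"
proof -
  let ?Q = "{q. sublinear q \<and> q \<le> p}"
  let ?R = "relation_of (\<ge>) ?Q"
  have "\<exists>m\<in>?Q. \<forall>q\<in>?Q. q \<le> m \<longrightarrow> q = m"
  proof (rule predicate_Zorn)
    show "partial_order_on ?Q ?R"
      by (rule partial_order_on_relation_ofI) auto
  next
    fix C assume "C \<in> Chains ?R"
    then have C: "C \<subseteq> ?Q" and lin: "\<And>q r. q \<in> C \<Longrightarrow> r \<in> C \<Longrightarrow> q \<le> r \<or> r \<le> q"
      by (auto simp: Chains_def relation_of_def)
    show "\<exists>u\<in>?Q. \<forall>q\<in>C. u \<le> q"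
    proof (cases "C = {}")
      case True
      then show ?thesis using assms by auto
    next
      case False
      \<comment> \<open>Every \<open>q \<le> p\<close> satisfies \<open>q x \<ge> - q (- x) \<ge> - p (- x)\<close>, so the infimum is finite.\<close>
      have "- p (- x) \<le> q x" if "q \<in> C" for q x
        using that C sublinear_ge_minus[of q x] by (force simp: le_fun_def dest: spec[of _ "- x"])
      then have bdd: "bdd_below ((\<lambda>q. q x) ` C)" for x
        by (auto intro!: bdd_belowI)
      let ?m = "\<lambda>x. INF q\<in>C. q x"
      have lower: "?m \<le> q" if "q \<in> C" for q
        using bdd that by (auto simp: le_fun_def intro: cINF_lower)
      moreover have "sublinear ?m"
        using False C lin bdd by (intro sublinear_INF_chain) auto
      moreover have "?m \<le> p"
        using False C lower by (blast intro: order_trans)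
      ultimately show ?thesis by blast
    qed
  qed
  then obtain f where "sublinear f" "f \<le> p"
    and "\<And>q. sublinear q \<Longrightarrow> q \<le> f \<Longrightarrow> q = f"
    by (fastforce intro: order_trans)
  then show thesis
    using minimal_sublinear_imp_linear that by blast
qed

text \<open>
  A linear \<open>f\<close> below the norm flattened along \<open>v\<close> satisfies $f(-v) \le -\|v\|$, which
  makes it norming at \<open>v\<close>.
\<close>

lemma norming_functional:
  fixes v :: "'a::real_normed_vector"
  obtains f :: "'a \<Rightarrow> real"
  where "bounded_linear f" "\<And>x. \<bar>f x\<bar> \<le> norm x" "f v = norm v"
proof -
  have sub: "sublinear (norm :: 'a \<Rightarrow> real)"
    by (auto simp: sublinear_def norm_triangle_ineq)
  obtain f where "linear f" and f: "f \<le> flatten_along norm v"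
    using linear_functional_below_sublinear[OF sublinear_flatten_along[OF sub]] by blast
  have le: "f x \<le> norm x" for x
    using f flatten_along_le_self[OF sub] by (auto simp: le_fun_def intro: order_trans)
  have "f (- v) \<le> - norm v"
    using f flatten_along_minus[OF sub, of v] by (auto simp: le_fun_def intro: order_trans)
  then have "f v = norm v"
    using le[of v] linear_neg[OF \<open>linear f\<close>, of v] by simp
  moreover have abs: "\<bar>f x\<bar> \<le> norm x" for x
    using le[of x] le[of "- x"] linear_neg[OF \<open>linear f\<close>, of x] by simp
  moreover have "bounded_linear f"
    using \<open>linear f\<close> abs
    by (auto simp: linear_conv_bounded_linear[symmetric] bounded_linear_def bounded_linear_axioms_def
        intro!: exI[of _ 1])
  ultimately show thesis using that by blast
qed

section \<open>Weakly closed and weakly compact sets\<close>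

lemma topspace_weak_topology [simp]: "topspace weak_topology = (UNIV :: 'a::real_normed_vector set)"
proof -
  have "(UNIV :: 'a set) \<in> {f -` U | (f :: 'a \<Rightarrow> real) U. bounded_linear f \<and> open U}"
    by (intro CollectI exI[of _ "\<lambda>_. 0"] exI[of _ UNIV]) (simp add: bounded_linear_zero)
  then show ?thesis
    unfolding weak_topology_def topology_generated_by_topspace by blast
qed

lemma continuous_map_weak_topology:
  fixes f :: "'a::real_normed_vector \<Rightarrow> real"
  assumes "bounded_linear f"
  shows "continuous_map weak_topology euclideanreal f"
proof -
  have "openin weak_topology (f -` U)" if "open U" for U
    unfolding weak_topology_def using assms that by (intro topology_generated_by_Basis) blast
  then show ?thesis
    by (simp add: continuous_map_def vimage_def)
qed

text \<open>
  The norm is weakly lower semicontinuous: by Hahn-Banach, $\|g(z)\| \le r$ is the conjunction of the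
  closed conditions $f(g(z)) \le r$ over all functionals \<open>f\<close> of norm at most one. The map \<open>g\<close>
  only needs to be weakly continuous, so that the lemma also covers differences of coordinates on
  a product of weak topologies.
\<close>

lemma closedin_norm_le:
  fixes g :: "'b \<Rightarrow> 'a::real_normed_vector"
  assumes "\<And>f :: 'a \<Rightarrow> real. bounded_linear f \<Longrightarrow> continuous_map X euclideanreal (\<lambda>z. f (g z))"
  shows "closedin X {z \<in> topspace X. norm (g z) \<le> r}"
proof -
  let ?F = "{f :: 'a \<Rightarrow> real. bounded_linear f \<and> (\<forall>x. \<bar>f x\<bar> \<le> norm x)}"
  have eq: "{z \<in> topspace X. norm (g z) \<le> r} = (\<Inter>f\<in>?F. {z \<in> topspace X. f (g z) \<in> {..r}})"
  proof (intro equalityI subsetI)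
    fix z assume z: "z \<in> (\<Inter>f\<in>?F. {z \<in> topspace X. f (g z) \<in> {..r}})"
    obtain f :: "'a \<Rightarrow> real" where f: "f \<in> ?F" "f (g z) = norm (g z)"
      by (rule norming_functional[of "g z"]) auto
    have "z \<in> {z \<in> topspace X. f (g z) \<in> {..r}}"
      using z f(1) by (rule InterD[OF _ imageI])
    then show "z \<in> {z \<in> topspace X. norm (g z) \<le> r}"
      using f(2) by simp
  next
    fix z assume "z \<in> {z \<in> topspace X. norm (g z) \<le> r}"
    then show "z \<in> (\<Inter>f\<in>?F. {z \<in> topspace X. f (g z) \<in> {..r}})"
      by (auto dest: spec[of _ "g z"])
  qed
  have "(\<lambda>_. 0) \<in> ?F"
    by (simp add: bounded_linear_zero)
  then have "?F \<noteq> {}" by blast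
  moreover have "closedin X {z \<in> topspace X. f (g z) \<in> {..r}}" if "f \<in> ?F" for f
    using that by (intro closedin_continuous_map_preimage[OF assms]) auto
  ultimately show ?thesis
    unfolding eq by (rule closedin_INT)
qed

lemma closedin_norm_diff_le:
  fixes g h :: "'b \<Rightarrow> 'a::real_normed_vector"
  assumes "\<And>f :: 'a \<Rightarrow> real. bounded_linear f \<Longrightarrow> continuous_map X euclideanreal (\<lambda>z. f (g z))"
    and "\<And>f :: 'a \<Rightarrow> real. bounded_linear f \<Longrightarrow> continuous_map X euclideanreal (\<lambda>z. f (h z))"
  shows "closedin X {z \<in> topspace X. norm (g z - h z) \<le> r}"
proof (rule closedin_norm_le)
  fix f :: "'a \<Rightarrow> real" assume "bounded_linear f"
  then show "continuous_map X euclideanreal (\<lambda>z. f (g z - h z))"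
    using assms by (simp add: linear_diff[OF bounded_linear.linear] continuous_map_diff)
qed

text \<open>
  Each functional is bounded on a weakly compact set \<open>A\<close>, so the dual space is the union of the
  closed sets \<open>C n\<close> of functionals bounded on \<open>A\<close> by \<open>n\<close>. By Baire, some \<open>C n\<close> contains a
  ball; adding to its centre a small multiple of a functional norming \<open>x\<close> bounds the norm of
  \<open>x\<close> uniformly over \<open>A\<close>.
\<close>

lemma weakly_compact_imp_bounded:
  fixes A :: "'a::real_normed_vector set"
  assumes "weakly_compact A"
  shows "bounded A"
proof -
  define C where "C n = {f :: 'a \<Rightarrow>\<^sub>L real. \<forall>x\<in>A. \<bar>blinfun_apply f x\<bar> \<le> real n}" for n
  have closed_C: "closed (C n)" for n
  proof -
    have "C n = (\<Inter>x\<in>A. {f. \<bar>blinfun_apply f x\<bar> \<le> real n})"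
      by (auto simp: C_def)
    then show ?thesis
      by (auto intro!: closed_INT closed_Collect_le continuous_intros)
  qed
  have "f \<in> (\<Union>n. C n)" for f
  proof -
    have "compactin euclideanreal (blinfun_apply f ` A)"
      using assms continuous_map_weak_topology[OF blinfun.bounded_linear_right]
      by (rule image_compactin)
    then have "bounded (blinfun_apply f ` A)"
      by (simp add: compact_imp_bounded)
    then obtain b where b: "\<bar>blinfun_apply f x\<bar> \<le> b" if "x \<in> A" for x
      by (auto simp: bounded_iff)
    obtain n :: nat where "b \<le> real n"
      using real_arch_simple by blast
    then have "f \<in> C n"
      using b by (force simp: C_def)
    then show ?thesis by blast
  qed
  then have union: "\<Union>(range C) = UNIV" by blast
  have "\<exists>n. interior (C n) \<noteq> {}"
  proof (rule ccontr)
    assume "\<nexists>n. interior (C n) \<noteq> {}"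
    then have "interior (\<Union>(range C)) = {}"
      using Met_TC.metric_Baire_category_alt[of "range C"] closed_C complete_UNIV by auto
    with union show False by simp
  qed
  then obtain n g where "g \<in> interior (C n)" by blast
  then obtain e where "e > 0" and e: "ball g e \<subseteq> C n"
    by (auto simp: mem_interior)
  have "norm x \<le> 4 * real n / e" if "x \<in> A" for x
  proof -
    obtain f :: "'a \<Rightarrow> real" where f: "bounded_linear f" "\<And>y. \<bar>f y\<bar> \<le> norm y" "f x = norm x"
      using norming_functional[of x] by blast
    have apply_f: "blinfun_apply (Blinfun f) = f"
      by (rule bounded_linear_Blinfun_apply[OF f(1)])
    have "norm (Blinfun f) \<le> 1"
      using f(2) by (intro norm_blinfun_bound) (auto simp: apply_f)
    then have "g + (e / 2) *\<^sub>R Blinfun f \<in> ball g e"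
      using \<open>e > 0\<close> by (simp add: dist_norm mult_le_one)
    moreover have "g \<in> ball g e" using \<open>e > 0\<close> by simp
    ultimately have "g + (e / 2) *\<^sub>R Blinfun f \<in> C n" "g \<in> C n"
      using e by blast+
    then have "\<bar>blinfun_apply (g + (e / 2) *\<^sub>R Blinfun f) x\<bar> \<le> real n" "\<bar>blinfun_apply g x\<bar> \<le> real n"
      using that by (simp_all add: C_def)
    then have "(e / 2) * norm x \<le> 2 * real n"
      by (simp add: blinfun.add_left blinfun.scaleR_left apply_f f(3))
    then show ?thesis using \<open>e > 0\<close> by (simp add: field_simps)
  qed
  then show ?thesis
    by (auto simp: bounded_iff)
qed

section \<open>Minimal invariant sets\<close>

text \<open>
  In a compact space the intersection of a chain of non-empty closed sets is non-empty, so Zorn's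
  lemma applies to the closed convex invariant sets.
\<close>

lemma minimal_invariant_closed_convex:
  fixes X :: "'a::real_vector topology"
  assumes "compact_space X" "topspace X \<noteq> {}" "convex (topspace X)"
    and "S ` topspace X \<subseteq> topspace X"
  obtains K where "K \<noteq> {}" "closedin X K" "convex K" "S ` K \<subseteq> K"
    and "\<And>L. L \<noteq> {} \<Longrightarrow> closedin X L \<Longrightarrow> convex L \<Longrightarrow> S ` L \<subseteq> L \<Longrightarrow> L \<subseteq> K \<Longrightarrow> L = K"
proof -
  let ?F = "{K. K \<noteq> {} \<and> closedin X K \<and> convex K \<and> S ` K \<subseteq> K}"
  let ?R = "relation_of (\<supseteq>) ?F"
  have "\<exists>K\<in>?F. \<forall>L\<in>?F. L \<subseteq> K \<longrightarrow> L = K"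
  proof (rule predicate_Zorn)
    show "partial_order_on ?F ?R"
      by (rule partial_order_on_relation_ofI) auto
  next
    fix C assume "C \<in> Chains ?R"
    then have C: "C \<subseteq> ?F" and lin: "\<And>K L. K \<in> C \<Longrightarrow> L \<in> C \<Longrightarrow> K \<subseteq> L \<or> L \<subseteq> K"
      by (auto simp: Chains_def relation_of_def)
    show "\<exists>U\<in>?F. \<forall>K\<in>C. U \<subseteq> K"
    proof (cases "C = {}")
      case True
      then show ?thesis using assms by blast
    next
      case False
      have "\<Inter>G \<noteq> {}" if "finite G" "G \<subseteq> C" for G
      proof (cases "G = {}")
        case False
        have "\<Inter>G \<in> G"
          using that False lin by (intro Inter_in_chain[where \<A> = C]) (auto simp: subset_chain_def)
        then show ?thesis using C that by blast
      qed simp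
      then have "(\<forall>K\<in>C. closedin X K) \<and> (\<forall>G. finite G \<and> G \<subseteq> C \<longrightarrow> \<Inter>G \<noteq> {})"
        using C by auto
      then have "\<Inter>C \<noteq> {}"
        by (rule assms(1)[unfolded compact_space_fip, THEN spec, THEN mp])
      moreover have "closedin X (\<Inter>C)"
        using False C by (intro closedin_Inter) auto
      moreover have "convex (\<Inter>C)"
        using C by (intro convex_Inter) auto
      moreover have "S ` (\<Inter>C) \<subseteq> \<Inter>C"
        using C by blast
      ultimately show ?thesis by blast
    qed
  qed
  then obtain K where K: "K \<in> ?F" and min: "\<forall>L\<in>?F. L \<subseteq> K \<longrightarrow> L = K"
    by (rule bexE)
  show thesis
  proof (rule that[of K])
    show "L = K" if "L \<noteq> {}" "closedin X L" "convex L" "S ` L \<subseteq> L" "L \<subseteq> K" for L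
      using min that by simp
  qed (use K in simp_all)
qed

section \<open>The partner map of a sharp proximinal pair\<close>

text \<open>
  The set is the projection to \<open>A\<close> of the set of pairs $(x,y) \in A \times B$ with
  $\|x - y\| \le d$ and $\|y - c\| \le r$. That set is closed for the product of the weak topologies,
  and the projection along the compact factor \<open>B\<close> is a closed map.
\<close>

lemma closedin_partner_norm_le:
  fixes A B :: "'a::real_normed_vector set"
  assumes "weakly_compact B"
    and partner: "\<And>x y. x \<in> A \<Longrightarrow> y \<in> B \<and> norm (x - y) \<le> d \<longleftrightarrow> y = J x"
  shows "closedin (subtopology weak_topology A) {x \<in> A. norm (J x - c) \<le> r}"
proof -
  let ?WA = "subtopology weak_topology A" and ?WB = "subtopology weak_topology B"
  let ?P = "prod_topology ?WA ?WB"
  have cont_fst: "continuous_map ?P euclideanreal (\<lambda>p. f (fst p))"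
    and cont_snd: "continuous_map ?P euclideanreal (\<lambda>p. f (snd p))"
    if "bounded_linear f" for f :: "'a \<Rightarrow> real"
  proof -
    have "continuous_map (subtopology weak_topology S) euclideanreal f" for S
      using continuous_map_weak_topology[OF that] by (rule continuous_map_from_subtopology)
    then show "continuous_map ?P euclideanreal (\<lambda>p. f (fst p))"
      and "continuous_map ?P euclideanreal (\<lambda>p. f (snd p))"
      using continuous_map_compose[OF continuous_map_fst] continuous_map_compose[OF continuous_map_snd]
      unfolding o_def by blast+
  qed
  define G where "G = {p \<in> topspace ?P. norm (fst p - snd p) \<le> d} \<inter>
    {p \<in> topspace ?P. norm (snd p - c) \<le> r}"
  have "closedin ?P G"
    unfolding G_def by (intro closedin_Int closedin_norm_diff_le) (simp_all add: cont_fst cont_snd)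
  moreover have "closed_map ?P ?WA fst"
    using assms(1) by (intro Abstract_Topological_Spaces.closed_map_fst compact_space_subtopology)
  ultimately have "closedin ?WA (fst ` G)"
    by (simp only: closed_map_def)
  moreover have "fst ` G = {x \<in> A. norm (J x - c) \<le> r}"
  proof (intro equalityI subsetI)
    fix x assume "x \<in> {x \<in> A. norm (J x - c) \<le> r}"
    then have "(x, J x) \<in> G"
      using partner[of x "J x"] by (simp add: G_def)
    then show "x \<in> fst ` G"
      by (rule rev_image_eqI) simp
  next
    fix x assume "x \<in> fst ` G"
    then obtain y where "(x, y) \<in> G" by auto
    then show "x \<in> {x \<in> A. norm (J x - c) \<le> r}"
      using partner[of x y] by (simp add: G_def)
  qed
  ultimately show ?thesis by simp
qed

text \<open>
  The convex combination of the partners is within distance \<open>d\<close> of the convex combination of the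
  points, so uniqueness identifies it as the partner.
\<close>

lemma partner_convex_combination:
  fixes A B :: "'a::real_normed_vector set"
  assumes "convex A" "convex B"
    and partner: "\<And>x y. x \<in> A \<Longrightarrow> y \<in> B \<and> norm (x - y) \<le> d \<longleftrightarrow> y = J x"
    and xy: "x \<in> A" "y \<in> A" and uv: "u \<ge> 0" "v \<ge> 0" "u + v = 1"
  shows "J (u *\<^sub>R x + v *\<^sub>R y) = u *\<^sub>R J x + v *\<^sub>R J y"
proof -
  have J: "J z \<in> B \<and> norm (z - J z) \<le> d" if "z \<in> A" for z
    using partner[OF that] by blast
  have "u *\<^sub>R J x + v *\<^sub>R J y \<in> B"
    using J xy uv \<open>convex B\<close> by (simp add: convexD)
  moreover have "norm (u *\<^sub>R x + v *\<^sub>R y - (u *\<^sub>R J x + v *\<^sub>R J y)) \<le> d"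
  proof -
    have "u *\<^sub>R x + v *\<^sub>R y - (u *\<^sub>R J x + v *\<^sub>R J y) = u *\<^sub>R (x - J x) + v *\<^sub>R (y - J y)"
      by (simp add: algebra_simps)
    also have "\<dots> \<in> cball 0 d"
      using J xy uv by (intro convexD[OF convex_cball]) auto
    finally show ?thesis by simp
  qed
  ultimately show ?thesis
    using partner[OF convexD[OF \<open>convex A\<close> xy uv], of "u *\<^sub>R J x + v *\<^sub>R J y"] by simp
qed

lemma convex_partner_norm_le:
  fixes A B :: "'a::real_normed_vector set"
  assumes "convex A" "convex B"
    and partner: "\<And>x y. x \<in> A \<Longrightarrow> y \<in> B \<and> norm (x - y) \<le> d \<longleftrightarrow> y = J x"
  shows "convex {x \<in> A. norm (J x - c) \<le> r}"
proof (rule convexI)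
  fix x y and u v :: real
  assume "x \<in> {x \<in> A. norm (J x - c) \<le> r}" "y \<in> {x \<in> A. norm (J x - c) \<le> r}"
    and uv: "0 \<le> u" "0 \<le> v" "u + v = 1"
  then have xy: "x \<in> A" "y \<in> A" and "J x \<in> cball c r" "J y \<in> cball c r"
    by (auto simp: dist_norm norm_minus_commute)
  then have "u *\<^sub>R J x + v *\<^sub>R J y \<in> cball c r"
    using uv by (intro convexD[OF convex_cball])
  then have "J (u *\<^sub>R x + v *\<^sub>R y) \<in> cball c r"
    using partner_convex_combination[OF assms xy uv] by simp
  then show "u *\<^sub>R x + v *\<^sub>R y \<in> {x \<in> A. norm (J x - c) \<le> r}"
    using xy uv \<open>convex A\<close> by (simp add: convexD dist_norm norm_minus_commute)
qed

section \<open>Existence of a best proximity pair\<close>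

lemma farthest_dist_orbit2_le:
  assumes "y \<in> M" "\<And>z. z \<in> M \<Longrightarrow> T (T z) \<in> M" "\<And>z. z \<in> M \<Longrightarrow> norm (x - z) \<le> r"
  shows "farthest_dist x (orbit2 T y) \<le> r"
proof -
  have "(T ^^ (2 * n)) y \<in> M" for n
    using assms(1,2) by (induction n) auto
  then show ?thesis
    unfolding farthest_dist_def orbit2_def using assms(3) by (intro cSUP_least) auto
qed

theorem theorem4p2:
  fixes A B :: "'a::banach set" and T :: "'a \<Rightarrow> 'a"
  assumes "A \<noteq> {}" and "B \<noteq> {}"
    and "closed A" and "closed B"
    and "weakly_compact A" and "weakly_compact B"
    and "convex A" and "convex B"
    and "sharp_proximinal_pair A B"
    and "pointwise_cyclic_contraction_orbits A B T"
  shows "\<exists>p. best_proximity_pair A B T p"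
proof -
  define d where "d = setdist A B"
  define J where "J x = (THE y. y \<in> B \<and> norm (x - y) = d)" for x
  define S where "S x = T (J x)" for x
  have d_le: "d \<le> norm (x - y)" if "x \<in> A" "y \<in> B" for x y
    using setdist_le_dist[OF that] by (simp add: d_def dist_norm)
  have partner: "y \<in> B \<and> norm (x - y) \<le> d \<longleftrightarrow> y = J x" if "x \<in> A" for x y
  proof -
    have ex1: "\<exists>!y. y \<in> B \<and> norm (x - y) = d"
      using assms(9) that by (simp add: sharp_proximinal_pair_def d_def)
    have "J x \<in> B \<and> norm (x - J x) = d"
      unfolding J_def by (rule theI'[OF ex1])
    then show ?thesis
      using ex1 d_le[OF that] by force
  qed
  have J_B: "J x \<in> B" and J_dist: "norm (x - J x) = d" if "x \<in> A" for x
    using partner[OF that] d_le[OF that] by (auto intro: antisym)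

  note contr = assms(10)[unfolded pointwise_cyclic_contraction_orbits_def cyclic_map_def d_def[symmetric]]
  have T_A: "T x \<in> B" if "x \<in> A" for x using contr that by blast
  have T_B: "T y \<in> A" if "y \<in> B" for y using contr that by blast
  have S_A: "S x \<in> A" if "x \<in> A" for x
    using that by (simp add: S_def J_B T_B)
  have T_eq: "T x = J (S x)" if "x \<in> A" for x
  proof -
    have "norm (T x - S x) = d"
      using contr that J_B J_dist unfolding S_def by blast
    then show ?thesis
      using partner[OF S_A[OF that], of "T x"] T_A[OF that] by (simp add: norm_minus_commute)
  qed

  obtain K where K: "K \<noteq> {}" "closedin (subtopology weak_topology A) K" "convex K" "S ` K \<subseteq> K"
    and minimal: "\<And>L. L \<noteq> {} \<Longrightarrow> closedin (subtopology weak_topology A) L \<Longrightarrow> convex L \<Longrightarrow>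
      S ` L \<subseteq> L \<Longrightarrow> L \<subseteq> K \<Longrightarrow> L = K"
  proof (rule minimal_invariant_closed_convex)
    show "compact_space (subtopology weak_topology A)"
      using assms(5) by (rule compact_space_subtopology)
    show "S ` topspace (subtopology weak_topology A) \<subseteq> topspace (subtopology weak_topology A)"
      using S_A by auto
  qed (use assms(1,7) in simp_all)
  have K_A: "K \<subseteq> A"
    using closedin_subset[OF K(2)] by simp
  have S_K: "S x \<in> K" if "x \<in> K" for x
    using K(4) that by blast

  have closed_J: "closedin (subtopology weak_topology A) {x \<in> K. norm (J x - c) \<le> r}"
    and convex_J: "convex {x \<in> K. norm (J x - c) \<le> r}" for c r
  proof -
    have eq: "{x \<in> K. norm (J x - c) \<le> r} = K \<inter> {x \<in> A. norm (J x - c) \<le> r}"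
      using K_A by auto
    show "closedin (subtopology weak_topology A) {x \<in> K. norm (J x - c) \<le> r}"
      unfolding eq using K(2) closedin_partner_norm_le[OF assms(6) partner] by (rule closedin_Int)
    show "convex {x \<in> K. norm (J x - c) \<le> r}"
      unfolding eq using K(3) convex_partner_norm_le[OF assms(7,8) partner] by (rule convex_Int)
  qed
  have closed_ball: "closedin (subtopology weak_topology A) {x \<in> K. norm (x - c) \<le> r}"
    and convex_ball: "convex {x \<in> K. norm (x - c) \<le> r}" for c r
  proof -
    have eq: "{x \<in> K. norm (x - c) \<le> r} = K \<inter> {x \<in> topspace (subtopology weak_topology A). norm (x - c) \<le> r}"
      using K_A by auto
    have "closedin (subtopology weak_topology A) {x \<in> topspace (subtopology weak_topology A). norm (x - c) \<le> r}"
      by (intro closedin_norm_diff_le)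
        (simp_all add: continuous_map_from_subtopology continuous_map_weak_topology)
    then show "closedin (subtopology weak_topology A) {x \<in> K. norm (x - c) \<le> r}"
      unfolding eq using K(2) by (intro closedin_Int)
    have "{x \<in> K. norm (x - c) \<le> r} = K \<inter> cball c r"
      by (auto simp: dist_norm norm_minus_commute)
    then show "convex {x \<in> K. norm (x - c) \<le> r}"
      using K(3) by (simp add: convex_Int)
  qed

  \<comment> \<open>\<open>H r\<close> collects the \<open>z\<close> for which \<open>z\<close> is within \<open>r\<close> of \<open>J ` K\<close> everywhere, and
    \<open>J z\<close> within \<open>r\<close> of \<open>K\<close>. The contraction at \<open>z\<close> turns the first condition for
    \<open>z\<close> into the second one for \<open>S z\<close>, the contraction at \<open>J z\<close> the second into the first.\<close>
  define H where "H r = {z \<in> K. \<forall>v\<in>K. norm (z - J v) \<le> r \<and> norm (J z - v) \<le> r}" for r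
  have contract: "\<exists>s. d \<le> s \<and> s \<le> r \<and> (d < r \<longrightarrow> s < r) \<and> S z \<in> H s"
    if z: "z \<in> H r" and "d \<le> r" for z r
  proof -
    have "z \<in> K" and z_J: "norm (z - J v) \<le> r" and J_z: "norm (J z - v) \<le> r" if "v \<in> K" for v
      using z that K(1) by (auto simp: H_def)
    then have "z \<in> K" using K(1) by blast
    then have "z \<in> A" "J z \<in> B" using K_A J_B by auto
    obtain \<alpha> where \<alpha>: "0 < \<alpha>" "\<alpha> < 1" and
      \<alpha>_le: "\<And>y. y \<in> B \<Longrightarrow> norm (T z - T y) \<le> \<alpha> * farthest_dist z (orbit2 T y) + (1 - \<alpha>) * d"
      using contr \<open>z \<in> A\<close> by metis
    obtain \<beta> where \<beta>: "0 < \<beta>" "\<beta> < 1" and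
      \<beta>_le: "\<And>u. u \<in> A \<Longrightarrow> norm (T (J z) - T u) \<le> \<beta> * farthest_dist (J z) (orbit2 T u) + (1 - \<beta>) * d"
      using contr \<open>J z \<in> B\<close> by metis
    \<comment> \<open>The larger of the two constants serves both inequalities, because \<open>d \<le> r\<close>.\<close>
    define s where "s = max \<alpha> \<beta> * r + (1 - max \<alpha> \<beta>) * d"
    have s_ge: "\<gamma> * t + (1 - \<gamma>) * d \<le> s" if "0 < \<gamma>" "\<gamma> \<le> max \<alpha> \<beta>" "t \<le> r" for \<gamma> t
    proof -
      have "\<gamma> * t \<le> \<gamma> * r"
        using that by (intro mult_left_mono) auto
      moreover
      have "\<gamma> * (r - d) \<le> max \<alpha> \<beta> * (r - d)"
        using that \<open>d \<le> r\<close> by (intro mult_right_mono) auto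
      ultimately show ?thesis by (simp add: s_def algebra_simps)
    qed
    have s_diff: "r - s = (1 - max \<alpha> \<beta>) * (r - d)" "s - d = max \<alpha> \<beta> * (r - d)"
      by (simp_all add: s_def algebra_simps)
    have "norm (S v - T z) \<le> s" if "v \<in> K" for v
    proof -
      have "farthest_dist z (orbit2 T (J v)) \<le> r"
      proof (rule farthest_dist_orbit2_le[where M = "J ` K"])
        show "T (T y) \<in> J ` K" if "y \<in> J ` K" for y
        proof -
          obtain w where "w \<in> K" "y = J w" using \<open>y \<in> J ` K\<close> by blast
          have "S w \<in> A"
            using S_K[OF \<open>w \<in> K\<close>] K_A by blast
          from T_eq[OF this] have "T (T y) = J (S (S w))"
            by (simp add: S_def[of w] \<open>y = J w\<close>)
          then show ?thesis using S_K \<open>w \<in> K\<close> by blast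
        qed
      qed (use that z_J in auto)
      then have "\<alpha> * farthest_dist z (orbit2 T (J v)) + (1 - \<alpha>) * d \<le> s"
        using \<alpha> by (intro s_ge) auto
      then show ?thesis
        using \<alpha>_le[of "J v"] that K_A J_B by (force simp: S_def norm_minus_commute)
    qed
    \<comment> \<open>The bound holds on \<open>S ` K\<close>, so this set is invariant under \<open>S\<close>; minimality extends the
      bound to \<open>K\<close>.\<close>
    then have "{v \<in> K. norm (v - T z) \<le> s} = K"
      using K(1) S_K by (intro minimal closed_ball convex_ball) blast+
    then have 1: "norm (J (S z) - v) \<le> s" if "v \<in> K" for v
      using that T_eq[OF \<open>z \<in> A\<close>] by (auto simp: norm_minus_commute)
    have "norm (J (S v) - S z) \<le> s" if "v \<in> K" for v
    proof -
      have "farthest_dist (J z) (orbit2 T v) \<le> r"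
      proof (rule farthest_dist_orbit2_le[where M = K])
        show "T (T y) \<in> K" if "y \<in> K" for y
          using that T_eq[of y] S_K[OF S_K[OF that]] K_A by (auto simp: S_def[of "S y"])
      qed (use that J_z in auto)
      then have "\<beta> * farthest_dist (J z) (orbit2 T v) + (1 - \<beta>) * d \<le> s"
        using \<beta> by (intro s_ge) auto
      then show ?thesis
        using \<beta>_le[of v] that K_A T_eq[of v] by (force simp: S_def[of z] norm_minus_commute)
    qed
    then have "{v \<in> K. norm (J v - S z) \<le> s} = K"
      using K(1) S_K by (intro minimal closed_J convex_J) blast+
    then have 2: "norm (S z - J v) \<le> s" if "v \<in> K" for v
      using that by (auto simp: norm_minus_commute)
    have "S z \<in> H s"
      using 1 2 S_K[OF \<open>z \<in> K\<close>] by (simp add: H_def)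
    moreover have "0 \<le> r - s" "0 \<le> s - d" "d < r \<Longrightarrow> 0 < r - s"
      unfolding s_diff using \<alpha> \<beta> \<open>d \<le> r\<close> by auto
    ultimately show ?thesis by auto
  qed

  have H_all: "H r = K" if "d \<le> r" "H r \<noteq> {}" for r
  proof (rule minimal)
    have H_eq: "H r = (\<Inter>v\<in>K. {z \<in> K. norm (z - J v) \<le> r} \<inter> {z \<in> K. norm (J z - v) \<le> r})"
      using K(1) by (auto simp: H_def)
    show "closedin (subtopology weak_topology A) (H r)"
      unfolding H_eq using K(1) closed_ball closed_J by (intro closedin_INT closedin_Int) auto
    show "convex (H r)"
      unfolding H_eq using convex_ball convex_J by (intro convex_INT convex_Int) auto
    have "H s \<subseteq> H r" if "s \<le> r" for s
      using that by (force simp: H_def)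
    then show "S ` H r \<subseteq> H r"
      using contract \<open>d \<le> r\<close> by blast
  qed (use that in \<open>auto simp: H_def\<close>)

  \<comment> \<open>Boundedness makes \<open>\<rho>\<close> below a genuine upper bound, not the default value of an unbounded
    supremum.\<close>
  have bdd: "bdd_above ((\<lambda>(u, v). norm (u - J v)) ` (K \<times> K))"
  proof -
    obtain a b where "\<And>x. x \<in> A \<Longrightarrow> norm x \<le> a" "\<And>x. x \<in> B \<Longrightarrow> norm x \<le> b"
      using assms(5,6) weakly_compact_imp_bounded unfolding bounded_iff by metis
    then have "norm (u - J v) \<le> a + b" if "u \<in> K" "v \<in> K" for u v
      using that K_A J_B by (meson norm_triangle_le_diff add_mono subsetD)
    then show ?thesis by (auto intro!: bdd_aboveI)
  qed
  define \<rho> where "\<rho> = (SUP (u, v)\<in>K \<times> K. norm (u - J v))"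
  have \<rho>: "norm (u - J v) \<le> \<rho>" if "u \<in> K" "v \<in> K" for u v
    unfolding \<rho>_def using cSUP_upper[OF _ bdd, of "(u, v)"] that by auto
  obtain z where "z \<in> K" using K(1) by blast
  then have "d \<le> \<rho>"
    using \<rho>[of z z] J_dist[of z] K_A by auto
  have "z \<in> H \<rho>"
    using \<rho> \<open>z \<in> K\<close> by (auto simp: H_def norm_minus_commute)
  then obtain s where "d \<le> s" "d < \<rho> \<Longrightarrow> s < \<rho>" "S z \<in> H s"
    using contract \<open>d \<le> \<rho>\<close> by blast
  then have "H s = K"
    using H_all by blast
  then have "\<rho> \<le> s"
    unfolding \<rho>_def using K(1) by (intro cSUP_least) (auto simp: H_def)
  then have "\<rho> = d"
    using \<open>d \<le> \<rho>\<close> \<open>d < \<rho> \<Longrightarrow> s < \<rho>\<close> by fastforce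

  have "z \<in> A" "S z \<in> A" "S z \<in> K"
    using \<open>z \<in> K\<close> S_K K_A by auto
  have "norm (z - T z) = d"
    using \<rho>[OF \<open>z \<in> K\<close> \<open>S z \<in> K\<close>] d_le[OF \<open>z \<in> A\<close> T_A[OF \<open>z \<in> A\<close>]] \<open>\<rho> = d\<close> T_eq[OF \<open>z \<in> A\<close>]
    by simp
  moreover have "norm (J z - T (J z)) = d"
    using \<rho>[OF \<open>S z \<in> K\<close> \<open>z \<in> K\<close>] d_le[OF \<open>S z \<in> A\<close> J_B[OF \<open>z \<in> A\<close>]] \<open>\<rho> = d\<close>
    by (simp add: S_def norm_minus_commute)
  ultimately have "best_proximity_pair A B T (z, J z)"
    using \<open>z \<in> A\<close> J_B by (simp add: best_proximity_pair_def d_def)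
  then show ?thesis by blast
qed

end
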